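(* For all $k,l\ge1$ and all $a_1,\ldots,a_k,b_1,\ldots,b_l\in\mathbb{N}^*$, $$m_{a_1\ldots a_k}\bullet m_{b_1\ldots b_l}=\sum_{i=1}^{k-1}m_{a_1\ldots a_{i-1}(a_i-1)(a_{i+1}\ldots a_k\star b_1\ldots b_l)}+m_{a_1\ldots a_kb_1\ldots b_l},$$ where the $i$-th term of the sum is understood to be $0$ if $a_i=1$.
   Context: $\mathbb{K}$ is a field of characteristic zero; $\mathbb{N}^*$ is the set of positive integers. On $\mathbb{K}\langle x_0,x_1\rangle$ (span of words in $x_0,x_1$, $\emptyset$ being the empty word and $x_1^0=\emptyset$), $\sqcup\!\sqcup$ is the shuffle product, and $\bullet$ is the bilinear (prelie) product determined inductively by: for all words $c,d$, $\emptyset\bullet d=0$, $(x_0c)\bullet d=x_0(c\bullet d)$, $(x_1c)\bullet d=x_1(c\bullet d)+x_0(c\sqcup\!\sqcup d)$. For a nonempty word $w=a_1\ldots a_k$ with letters in $\mathbb{N}^*$, $m_w=x_1^{a_1-1}\bullet(x_1^{a_2-1}\bullet(\ldots(x_1^{a_{k-1}-1}\bullet x_1^{a_k-1})\ldots))$; the map $w\mapsto m_w$ is extended linearly to the span $\mathbb{K}\langle\mathbb{N}^*\rangle$ of such words. In the index of $m$, letters written in front of an element of $\mathbb{K}\langle\mathbb{N}^*\rangle$ denote concatenation on the left, extended linearly; $(a_i-1)$ is a single letter. The product $\star$ on $\mathbb{K}\langle\mathbb{N}^*\rangle$ is $\star=\prec+\succ$, where $$(a_1\ldots a_k)\prec(b_1\ldots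 b_l)=\sum_{\zeta\in Sh_\prec(k,l)}\zeta.\bigl(a_1\ldots a_kb_1\ldots b_{l-1}(b_l+1)\bigr),$$ $$(a_1\ldots a_k)\succ(b_1\ldots b_l)=\sum_{\zeta\in Sh_\succ(k,l)}\zeta.\bigl(a_1\ldots a_{k-1}(a_k+1)b_1\ldots b_l\bigr).$$ Here $Sh(k,l)$ is the set of permutations $\zeta\in\mathfrak{S}_{k+l}$ with $\zeta(1)<\ldots<\zeta(k)$ and $\zeta(k+1)<\ldots<\zeta(k+l)$; $Sh_\prec(k,l)$ (resp. $Sh_\succ(k,l)$) is the set of $\zeta\in Sh(k,l)$ with $\zeta^{-1}(k+l)=k$ (resp. $\zeta^{-1}(k+l)=k+l$); and $\sigma.(c_1\ldots c_n)=c_{\sigma^{-1}(1)}\ldots c_{\sigma^{-1}(n)}$. *)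

theory Defs
  imports
    "HOL-Library.Poly_Mapping"
    "HOL-Combinatorics.Permutations"
begin

text \<open>
  The span of the words over an alphabet \<open>'a\<close> with coefficients in \<open>'k\<close> is the type
  \<open>'a list \<Rightarrow>\<^sub>0 'k\<close> of finitely supported functions; no multiplication on the words is used.
\<close>

definition word :: "'a list \<Rightarrow> ('a list \<Rightarrow>\<^sub>0 'k::comm_ring_1)" where
  "word w = Poly_Mapping.single w 1"

definition smult :: "'k::comm_ring_1 \<Rightarrow> ('b \<Rightarrow>\<^sub>0 'k) \<Rightarrow> ('b \<Rightarrow>\<^sub>0 'k)" where
  "smult c p = Poly_Mapping.map ((*) c) p"

definition linear_ext ::
    "('a \<Rightarrow> ('b \<Rightarrow>\<^sub>0 'k)) \<Rightarrow> ('a \<Rightarrow>\<^sub>0 'k) \<Rightarrow> ('b \<Rightarrow>\<^sub>0 'k::comm_ring_1)" where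
  "linear_ext f p = (\<Sum>u\<in>Poly_Mapping.keys p. smult (Poly_Mapping.lookup p u) (f u))"

definition bilinear_ext ::
    "('a \<Rightarrow> 'b \<Rightarrow> ('c \<Rightarrow>\<^sub>0 'k)) \<Rightarrow> ('a \<Rightarrow>\<^sub>0 'k) \<Rightarrow> ('b \<Rightarrow>\<^sub>0 'k) \<Rightarrow> ('c \<Rightarrow>\<^sub>0 'k::comm_ring_1)" where
  "bilinear_ext f p q =
     (\<Sum>u\<in>Poly_Mapping.keys p. \<Sum>v\<in>Poly_Mapping.keys q.
        smult (Poly_Mapping.lookup p u * Poly_Mapping.lookup q v) (f u v))"

definition prefix_concat :: "'a list \<Rightarrow> ('a list \<Rightarrow>\<^sub>0 'k) \<Rightarrow> ('a list \<Rightarrow>\<^sub>0 'k::comm_ring_1)" where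
  "prefix_concat u = linear_ext (\<lambda>w. word (u @ w))"

datatype letter = X0 | X1

text \<open>The library function \<open>shuffles\<close> yields a set and forgets multiplicities, so it cannot be
  used for the shuffle product.\<close>

fun shuffle_words :: "'a list \<Rightarrow> 'a list \<Rightarrow> ('a list \<Rightarrow>\<^sub>0 'k::comm_ring_1)" where
  "shuffle_words [] d = word d"
| "shuffle_words (x # c) [] = word (x # c)"
| "shuffle_words (x # c) (y # d) =
     prefix_concat [x] (shuffle_words c (y # d)) + prefix_concat [y] (shuffle_words (x # c) d)"

fun prelie_words :: "letter list \<Rightarrow> letter list \<Rightarrow> (letter list \<Rightarrow>\<^sub>0 'k::comm_ring_1)" where
  "prelie_words [] d = 0"
| "prelie_words (X0 # c) d = prefix_concat [X0] (prelie_words c d)"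
| "prelie_words (X1 # c) d =
     prefix_concat [X1] (prelie_words c d) + prefix_concat [X0] (shuffle_words c d)"

definition prelie ::
    "(letter list \<Rightarrow>\<^sub>0 'k) \<Rightarrow> (letter list \<Rightarrow>\<^sub>0 'k) \<Rightarrow> (letter list \<Rightarrow>\<^sub>0 'k::comm_ring_1)"
    (infixl "\<bullet>" 70) where
  "p \<bullet> q = bilinear_ext prelie_words p q"

text \<open>
  Words with positive integer letters are represented as nonempty lists of type \<open>nat list\<close>
  without the entry \<open>0\<close>. On the empty list and on lists containing \<open>0\<close> the values of the
  following functions carry no meaning.
\<close>

fun m_word :: "nat list \<Rightarrow> (letter list \<Rightarrow>\<^sub>0 'k::comm_ring_1)" where
  "m_word [] = 0"
| "m_word [a] = word (replicate (a - 1) X1)"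
| "m_word (a # b # w) = word (replicate (a - 1) X1) \<bullet> m_word (b # w)"

definition m :: "(nat list \<Rightarrow>\<^sub>0 'k) \<Rightarrow> (letter list \<Rightarrow>\<^sub>0 'k::comm_ring_1)" where
  "m = linear_ext m_word"

definition Sh :: "nat \<Rightarrow> nat \<Rightarrow> (nat \<Rightarrow> nat) set" where
  "Sh k l = {\<zeta>. \<zeta> permutes {1..k + l} \<and>
     strict_mono_on {1..k} \<zeta> \<and> strict_mono_on {k + 1..k + l} \<zeta>}"

definition Sh_prec :: "nat \<Rightarrow> nat \<Rightarrow> (nat \<Rightarrow> nat) set" where
  "Sh_prec k l = {\<zeta> \<in> Sh k l. inv \<zeta> (k + l) = k}"

definition Sh_succ :: "nat \<Rightarrow> nat \<Rightarrow> (nat \<Rightarrow> nat) set" where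
  "Sh_succ k l = {\<zeta> \<in> Sh k l. inv \<zeta> (k + l) = k + l}"

text \<open>Permutations act on positions \<open>1, \<dots>, n\<close>, whereas list indices start at \<open>0\<close>.\<close>

definition perm_act :: "(nat \<Rightarrow> nat) \<Rightarrow> 'a list \<Rightarrow> 'a list" where
  "perm_act \<sigma> c = map (\<lambda>i. c ! (inv \<sigma> i - 1)) [1..<length c + 1]"

definition incr_last :: "nat list \<Rightarrow> nat list" where
  "incr_last a = butlast a @ [last a + 1]"

definition prec_words :: "nat list \<Rightarrow> nat list \<Rightarrow> (nat list \<Rightarrow>\<^sub>0 'k::comm_ring_1)" where
  "prec_words a b =
     (\<Sum>\<zeta>\<in>Sh_prec (length a) (length b). word (perm_act \<zeta> (a @ incr_last b)))"

definition succ_words :: "nat list \<Rightarrow> nat list \<Rightarrow> (nat list \<Rightarrow>\<^sub>0 'k::comm_ring_1)" where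
  "succ_words a b =
     (\<Sum>\<zeta>\<in>Sh_succ (length a) (length b). word (perm_act \<zeta> (incr_last a @ b)))"

definition prec ::
    "(nat list \<Rightarrow>\<^sub>0 'k) \<Rightarrow> (nat list \<Rightarrow>\<^sub>0 'k) \<Rightarrow> (nat list \<Rightarrow>\<^sub>0 'k::comm_ring_1)"
    (infixl "\<prec>" 70) where
  "p \<prec> q = bilinear_ext prec_words p q"

definition succ ::
    "(nat list \<Rightarrow>\<^sub>0 'k) \<Rightarrow> (nat list \<Rightarrow>\<^sub>0 'k) \<Rightarrow> (nat list \<Rightarrow>\<^sub>0 'k::comm_ring_1)"
    (infixl "\<succ>" 70) where
  "p \<succ> q = bilinear_ext succ_words p q"

definition star ::
    "(nat list \<Rightarrow>\<^sub>0 'k) \<Rightarrow> (nat list \<Rightarrow>\<^sub>0 'k) \<Rightarrow> (nat list \<Rightarrow>\<^sub>0 'k::comm_ring_1)"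
    (infixl "\<star>" 70) where
  "p \<star> q = p \<prec> q + p \<succ> q"

end

(* Let R be left multiplication by x0. Since x1^(n+1) \<bullet> p is the shuffle of x1^n and R p,
   m_{a w} is the shuffle of x1^(a-2) (or of 0, if a = 1) and R m_w. As \<bullet> p is a derivation
   of the shuffle product, (x1^(a-1) \<bullet> y) \<bullet> z - x1^(a-1) \<bullet> (y \<bullet> z) is
   the shuffle of x1^(a-3), R y and R z (0 if a <= 2). For y = m_w and z = m_b the shuffle of
   R y and R z is R m_{w \<star> b}: a recursion on the first letter shows that m_{w \<star> b}
   is the sum of the shuffle of R m_w with m_b and of m_w with R m_b. *)

theory Submission
  imports Defs
begin

section \<open>Linear operators on finitely supported functions\<close>

lemma lookup_smult: "Poly_Mapping.lookup (smult c p) u = c * Poly_Mapping.lookup p u"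
  by (simp add: smult_def Poly_Mapping.map.rep_eq when_def)

lemma smult_simps [simp]:
  "smult c 0 = 0" "smult 0 p = 0" "smult 1 p = p"
  "smult c (p + q) = smult c p + smult c q"
  "smult (c + d) p = smult c p + smult d p"
  "smult c (smult d p) = smult (c * d) p"
  by (rule poly_mapping_eqI; simp add: lookup_smult lookup_add algebra_simps)+

lemma smult_sum: "smult c (sum f A) = (\<Sum>x\<in>A. smult c (f x))"
  by (induction A rule: infinite_finite_induct) auto

lemma sum_smult_word:
  "(\<Sum>u\<in>Poly_Mapping.keys p. smult (Poly_Mapping.lookup p u) (word u)) = p"
proof (rule poly_mapping_eqI)
  fix v
  have "(\<Sum>u\<in>Poly_Mapping.keys p. Poly_Mapping.lookup p u * Poly_Mapping.lookup (word u) v) =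
      (\<Sum>u\<in>Poly_Mapping.keys p. if u = v then Poly_Mapping.lookup p u else 0)"
    by (rule sum.cong) (auto simp: word_def lookup_single)
  then show "Poly_Mapping.lookup
      (\<Sum>u\<in>Poly_Mapping.keys p. smult (Poly_Mapping.lookup p u) (word u)) v =
      Poly_Mapping.lookup p v"
    by (simp add: lookup_sum lookup_smult in_keys_iff)
qed

text \<open>Words outside the support have coefficient 0. Summing over a larger finite set puts
  \<open>p\<close>, \<open>q\<close> and \<open>p + q\<close> over a common index set in the proof
  of additivity.\<close>

lemma linear_ext_superset:
  assumes "finite A" "Poly_Mapping.keys p \<subseteq> A"
  shows "linear_ext f p = (\<Sum>u\<in>A. smult (Poly_Mapping.lookup p u) (f u))"
  unfolding linear_ext_def using assms
  by (intro sum.mono_neutral_left) (auto simp: in_keys_iff)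

definition linear_op :: "(('a \<Rightarrow>\<^sub>0 'k) \<Rightarrow> ('b \<Rightarrow>\<^sub>0 'k::comm_ring_1)) \<Rightarrow> bool" where
  "linear_op F \<longleftrightarrow> (\<forall>p q. F (p + q) = F p + F q) \<and> (\<forall>c p. F (smult c p) = smult c (F p))"

lemma linear_op_add: "linear_op F \<Longrightarrow> F (p + q) = F p + F q"
  and linear_op_smult: "linear_op F \<Longrightarrow> F (smult c p) = smult c (F p)"
  by (simp_all add: linear_op_def)

lemma linear_op_zero: "linear_op F \<Longrightarrow> F 0 = 0"
  using linear_op_smult[of F 0 0] by simp

lemma linear_op_sum: "linear_op F \<Longrightarrow> F (sum f A) = (\<Sum>x\<in>A. F (f x))"
  by (induction A rule: infinite_finite_induct) (auto simp: linear_op_zero linear_op_add)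

lemma linear_op_id: "linear_op (\<lambda>p. p)"
  by (simp add: linear_op_def)

lemma linear_op_comp: "linear_op F \<Longrightarrow> linear_op G \<Longrightarrow> linear_op (\<lambda>p. F (G p))"
  by (simp add: linear_op_def)

lemma linear_op_plus: "linear_op F \<Longrightarrow> linear_op G \<Longrightarrow> linear_op (\<lambda>p. F p + G p)"
  by (simp add: linear_op_def algebra_simps)

text \<open>Every element is a combination of words. The identities below are reduced to words with
  this rule, one argument at a time.\<close>

lemma linear_op_eqI:
  fixes F G :: "('a list \<Rightarrow>\<^sub>0 'b) \<Rightarrow> ('c \<Rightarrow>\<^sub>0 'b::comm_ring_1)"
  assumes "linear_op F" "linear_op G" "\<And>w. F (word w) = G (word w)"
  shows "F p = G p"
proof -
  have "F p = (\<Sum>u\<in>Poly_Mapping.keys p. smult (Poly_Mapping.lookup p u) (F (word u)))"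
    if "linear_op F" for F :: "('a list \<Rightarrow>\<^sub>0 'b) \<Rightarrow> ('c \<Rightarrow>\<^sub>0 'b::comm_ring_1)"
    by (subst sum_smult_word[of p, symmetric]) (simp only: linear_op_sum[OF that] linear_op_smult[OF that])
  from this[OF assms(1)] this[OF assms(2)] show ?thesis
    by (simp add: assms(3))
qed

lemma linear_op_linear_ext: "linear_op (linear_ext f)"
  unfolding linear_op_def
proof (intro conjI allI)
  fix p q :: "'a \<Rightarrow>\<^sub>0 'b"
  let ?A = "Poly_Mapping.keys p \<union> Poly_Mapping.keys q"
  have "linear_ext f (p + q) = (\<Sum>u\<in>?A. smult (Poly_Mapping.lookup (p + q) u) (f u))"
    by (rule linear_ext_superset) (auto dest: keys_add[THEN subsetD])
  then show "linear_ext f (p + q) = linear_ext f p + linear_ext f q"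
    by (simp add: linear_ext_superset[of ?A p] linear_ext_superset[of ?A q]
        lookup_add sum.distrib)
next
  fix c and p :: "'a \<Rightarrow>\<^sub>0 'b"
  have "Poly_Mapping.keys (smult c p) \<subseteq> Poly_Mapping.keys p"
    by (auto simp: in_keys_iff lookup_smult)
  then have "linear_ext f (smult c p) =
      (\<Sum>u\<in>Poly_Mapping.keys p. smult (Poly_Mapping.lookup (smult c p) u) (f u))"
    by (intro linear_ext_superset) auto
  then show "linear_ext f (smult c p) = smult c (linear_ext f p)"
    by (simp add: linear_ext_def smult_sum lookup_smult)
qed

lemma linear_ext_word [simp]: "linear_ext f (word u) = f u"
  by (simp add: linear_ext_superset[of "{u}"] word_def)

text \<open>As an iterated linear extension, the bilinear extension inherits linearity in each
  argument.\<close>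

lemma bilinear_ext_altdef: "bilinear_ext f p q = linear_ext (\<lambda>u. linear_ext (f u) q) p"
  by (simp add: bilinear_ext_def linear_ext_def smult_sum)

lemma linear_op_bilinear_ext_left: "linear_op (\<lambda>p. bilinear_ext f p q)"
  unfolding bilinear_ext_altdef by (rule linear_op_linear_ext)

lemma linear_ext_pointwise:
  "linear_ext (\<lambda>u. f u + g u) p = linear_ext f p + linear_ext g p"
  "linear_ext (\<lambda>u. smult c (f u)) p = smult c (linear_ext f p)"
  by (simp_all add: linear_ext_def sum.distrib smult_sum mult.commute)

lemma linear_op_bilinear_ext_right: "linear_op (bilinear_ext f p)"
  unfolding linear_op_def bilinear_ext_altdef
  by (simp add: linear_op_add[OF linear_op_linear_ext] linear_op_smult[OF linear_op_linear_ext]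
      linear_ext_pointwise)

lemma bilinear_ext_word [simp]: "bilinear_ext f (word u) (word v) = f u v"
  by (simp add: bilinear_ext_altdef)

lemma linear_op_prefix_concat: "linear_op (prefix_concat u)"
  unfolding prefix_concat_def by (rule linear_op_linear_ext)

lemma prefix_concat_word [simp]: "prefix_concat u (word w) = word (u @ w)"
  by (simp add: prefix_concat_def)

lemmas prefix_concat_linear [simp] =
  linear_op_add[OF linear_op_prefix_concat] linear_op_zero[OF linear_op_prefix_concat]

lemma prefix_concat_append: "prefix_concat (u @ v) p = prefix_concat u (prefix_concat v p)"
  by (rule linear_op_eqI[of "prefix_concat (u @ v)" "\<lambda>p. prefix_concat u (prefix_concat v p)"])
    (simp_all add: linear_op_prefix_concat linear_op_comp[OF linear_op_prefix_concat linear_op_prefix_concat])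


section \<open>The shuffle product and the prelie product\<close>

definition shuffle ::
    "('a list \<Rightarrow>\<^sub>0 'k) \<Rightarrow> ('a list \<Rightarrow>\<^sub>0 'k) \<Rightarrow> ('a list \<Rightarrow>\<^sub>0 'k::comm_ring_1)"
    (infixl "\<diamondop>" 75) where
  "p \<diamondop> q = bilinear_ext shuffle_words p q"

lemma linear_op_shuffle_left: "linear_op (\<lambda>p. p \<diamondop> q)"
  unfolding shuffle_def by (rule linear_op_bilinear_ext_left)

lemma linear_op_shuffle_right: "linear_op (\<lambda>q. p \<diamondop> q)"
  unfolding shuffle_def by (rule linear_op_bilinear_ext_right)

lemma linear_op_prelie_left: "linear_op (\<lambda>p. p \<bullet> q)"
  unfolding prelie_def by (rule linear_op_bilinear_ext_left)

lemma linear_op_prelie_right: "linear_op (\<lambda>q. p \<bullet> q)"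
  unfolding prelie_def by (rule linear_op_bilinear_ext_right)

lemmas shuffle_linear [simp] =
  linear_op_add[OF linear_op_shuffle_left] linear_op_zero[OF linear_op_shuffle_left]
  linear_op_add[OF linear_op_shuffle_right] linear_op_zero[OF linear_op_shuffle_right]

lemmas prelie_linear [simp] =
  linear_op_add[OF linear_op_prelie_left] linear_op_zero[OF linear_op_prelie_left]
  linear_op_add[OF linear_op_prelie_right] linear_op_zero[OF linear_op_prelie_right]

lemmas linear_op_intros = linear_op_id linear_op_plus linear_op_prefix_concat
  linear_op_comp[OF linear_op_prefix_concat]
  linear_op_comp[OF linear_op_shuffle_left] linear_op_comp[OF linear_op_shuffle_right]
  linear_op_comp[OF linear_op_prelie_left] linear_op_comp[OF linear_op_prelie_right]

lemma shuffle_word_word: "word c \<diamondop> word d = shuffle_words c d"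
  by (simp add: shuffle_def)

lemma prelie_word_word: "word c \<bullet> word d = prelie_words c d"
  by (simp add: prelie_def)

lemma shuffle_Nil_left [simp]: "word [] \<diamondop> p = p"
  by (rule linear_op_eqI[of "\<lambda>p. _ \<diamondop> p" "\<lambda>p. p"])
    (auto intro!: linear_op_intros simp: shuffle_word_word)

lemma shuffle_Nil_right [simp]: "p \<diamondop> word [] = p"
proof (rule linear_op_eqI[of "\<lambda>p. p \<diamondop> _" "\<lambda>p. p"])
  show "word w \<diamondop> word [] = (word w :: _ \<Rightarrow>\<^sub>0 'b)" for w :: "'a list"
      by (cases w) (simp_all add: shuffle_word_word)
qed (auto intro!: linear_op_intros)

lemma shuffle_prefix_prefix [simp]:
  "prefix_concat [x] p \<diamondop> prefix_concat [y] q =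
     prefix_concat [x] (p \<diamondop> prefix_concat [y] q) + prefix_concat [y] (prefix_concat [x] p \<diamondop> q)"
proof (rule linear_op_eqI[of "\<lambda>p. prefix_concat [x] p \<diamondop> _" "\<lambda>p. prefix_concat [x] (p \<diamondop> _) + _ p"])
  fix u
  show "prefix_concat [x] (word u) \<diamondop> prefix_concat [y] q =
    prefix_concat [x] (word u \<diamondop> prefix_concat [y] q)
      + prefix_concat [y] (prefix_concat [x] (word u) \<diamondop> q)"
    by (rule linear_op_eqI[of "\<lambda>q. _ \<diamondop> prefix_concat [y] q"])
      (auto intro!: linear_op_intros simp: shuffle_word_word)
qed (auto intro!: linear_op_intros)

text \<open>Used with \<open>prefix_concat_word\<close> switched off: once a first letter is written
  as an operator, the recursions for arbitrary elements apply to words.\<close>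

lemma word_Cons: "word (x # c) = prefix_concat [x] (word c)"
  by simp

lemma shuffle_commute_words: "word c \<diamondop> word d = (word d \<diamondop> word c :: _ \<Rightarrow>\<^sub>0 'k::comm_ring_1)"
  by (induction c d rule: shuffle_words.induct)
    (simp_all add: word_Cons add.commute del: prefix_concat_word)

lemma shuffle_commute: "p \<diamondop> q = q \<diamondop> p"
proof (rule linear_op_eqI[of "\<lambda>p. p \<diamondop> _"])
  show "word c \<diamondop> q = q \<diamondop> word c" for c
    by (rule linear_op_eqI[of "\<lambda>p. _ \<diamondop> p"])
      (auto intro!: linear_op_intros simp: shuffle_commute_words)
qed (auto intro!: linear_op_intros)

lemma shuffle_assoc_words:
  "(word c \<diamondop> word d) \<diamondop> word e = (word c \<diamondop> (word d \<diamondop> word e) :: _ \<Rightarrow>\<^sub>0 'k::comm_ring_1)"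
proof (induction "length c + length d + length e" arbitrary: c d e rule: less_induct)
  case less
  show ?case
  proof (cases "c = [] \<or> d = [] \<or> e = []")
    case False
    then obtain x c' y d' z e' where "c = x # c'" "d = y # d'" "e = z # e'"
      by (metis neq_Nil_conv)
    \<comment> \<open>Both sides are sums of three terms, by the word that supplies the first
      letter. On the left the letter \<open>z\<close> comes up twice, on the right \<open>x\<close>
      does; such pairs are merged by reading the shuffle recursion backwards.\<close>
    then show ?thesis
      using less[of c' d e] less[of c d' e] less[of c d e']
      by (simp add: word_Cons add_ac del: prefix_concat_word)
        (metis linear_op_add[OF linear_op_prefix_concat] shuffle_prefix_prefix)
  qed auto
qed

lemma shuffle_assoc: "(p \<diamondop> q) \<diamondop> r = p \<diamondop> (q \<diamondop> r)"
proof (rule linear_op_eqI[of "\<lambda>p. (p \<diamondop> q) \<diamondop> r"])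
  show "(word c \<diamondop> q) \<diamondop> r = word c \<diamondop> (q \<diamondop> r)" for c
  proof (rule linear_op_eqI[of "\<lambda>q. (_ \<diamondop> q) \<diamondop> r"])
    show "(word c \<diamondop> word d) \<diamondop> r = word c \<diamondop> (word d \<diamondop> r)" for d
      by (rule linear_op_eqI[of "\<lambda>r. _ \<diamondop> r"])
        (auto intro!: linear_op_intros simp: shuffle_assoc_words)
  qed (auto intro!: linear_op_intros)
qed (auto intro!: linear_op_intros)

lemma shuffle_left_commute: "p \<diamondop> (q \<diamondop> r) = q \<diamondop> (p \<diamondop> r)"
  by (metis shuffle_assoc shuffle_commute)

lemmas shuffle_ac = shuffle_assoc shuffle_commute shuffle_left_commute

section \<open>The map \<open>\<lambda>q. q \<bullet> p\<close> as a derivation of the shuffle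
  product\<close>

lemma prelie_Nil_left [simp]: "word [] \<bullet> p = 0"
  by (simp add: prelie_def bilinear_ext_altdef) (simp add: linear_ext_def)

lemma prelie_X0 [simp]: "prefix_concat [X0] p \<bullet> q = prefix_concat [X0] (p \<bullet> q)"
proof (rule linear_op_eqI[of "\<lambda>p. prefix_concat _ p \<bullet> q"])
  show "prefix_concat [X0] (word c) \<bullet> q = prefix_concat [X0] (word c \<bullet> q)" for c
    by (rule linear_op_eqI[of "\<lambda>q. _ \<bullet> q"]) (auto intro!: linear_op_intros simp: prelie_word_word)
qed (auto intro!: linear_op_intros)

lemma prelie_X1 [simp]:
  "prefix_concat [X1] p \<bullet> q = prefix_concat [X1] (p \<bullet> q) + prefix_concat [X0] (p \<diamondop> q)"
proof (rule linear_op_eqI[of "\<lambda>p. prefix_concat _ p \<bullet> q"])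
  show "prefix_concat [X1] (word c) \<bullet> q =
      prefix_concat [X1] (word c \<bullet> q) + prefix_concat [X0] (word c \<diamondop> q)" for c
    by (rule linear_op_eqI[of "\<lambda>q. _ \<bullet> q"])
      (auto intro!: linear_op_intros simp: prelie_word_word shuffle_word_word)
qed (auto intro!: linear_op_intros)

text \<open>Multiplying by \<open>p\<close> on the right turns one letter \<open>X1\<close> at a
  time into \<open>X0\<close> and shuffles \<open>p\<close> into the letters behind it. In a shuffle
  of \<open>c\<close> and \<open>d\<close> these letters are a shuffle of two tails, and
  \<open>p\<close> may be attached to either tail.\<close>

lemma prelie_shuffle_words:
  "(word c \<diamondop> word d) \<bullet> p = (word c \<bullet> p) \<diamondop> word d + word c \<diamondop> (word d \<bullet> p)"
proof (induction "length c + length d" arbitrary: c d rule: less_induct)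
  case less
  show ?case
  proof (cases "c = [] \<or> d = []")
    case False
    then obtain x c' y d' where eq: "c = x # c'" "d = y # d'"
      by (metis neq_Nil_conv)
    \<comment> \<open>The two equations serve as rewrite rules that move \<open>p\<close> to the end
      of every product, so that matching terms become identical.\<close>
    have *: "q \<diamondop> p \<diamondop> r = q \<diamondop> r \<diamondop> p" for q r
      by (metis shuffle_assoc shuffle_commute)
    have **: "q \<diamondop> (r \<diamondop> p) = q \<diamondop> r \<diamondop> p" for q r
      by (simp add: shuffle_assoc)
    show ?thesis
      unfolding eq using less[of c' d] less[of c d']
      by (cases x; cases y)
        (simp_all add: eq word_Cons * ** add_ac del: prefix_concat_word)
  qed auto
qed

lemma prelie_shuffle: "(p \<diamondop> q) \<bullet> r = (p \<bullet> r) \<diamondop> q + p \<diamondop> (q \<bullet> r)"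
proof (rule linear_op_eqI[of "\<lambda>p. (p \<diamondop> q) \<bullet> r"])
  show "(word c \<diamondop> q) \<bullet> r = (word c \<bullet> r) \<diamondop> q + word c \<diamondop> (q \<bullet> r)" for c
    by (rule linear_op_eqI[of "\<lambda>q. (_ \<diamondop> q) \<bullet> r"])
      (auto intro!: linear_op_intros simp: prelie_shuffle_words)
qed (auto intro!: linear_op_intros)

abbreviation x0 :: "(letter list \<Rightarrow>\<^sub>0 'k) \<Rightarrow> (letter list \<Rightarrow>\<^sub>0 'k::comm_ring_1)" where
  "x0 \<equiv> prefix_concat [X0]"

text \<open>Both sides satisfy the same recursion: one more \<open>X1\<close> gives
  \<open>X1\<close> in front of the previous value plus \<open>X0\<close> in front of the shuffle of
  x1^(n+1) and \<open>p\<close>. Both start at \<open>x0 p\<close>.\<close>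

lemma replicate_X1_prelie:
  "word (replicate (Suc n) X1) \<bullet> p = word (replicate n X1) \<diamondop> x0 p"
  by (induction n) (simp_all add: word_Cons del: prefix_concat_word)


section \<open>Shuffles as permutations and as words\<close>

lemma filter_eq_sorted_list_iff:
  fixes xs zs :: "'a::linorder list"
  assumes "sorted_wrt (<) xs" "set (filter P zs) = set xs"
  shows "filter P zs = xs \<longleftrightarrow> sorted_wrt (<) (filter P zs)"
  using assms by (metis strict_sorted_equal)

lemma sorted_wrt_filter_iff:
  "sorted_wrt R (filter P xs) \<longleftrightarrow> sorted_wrt (\<lambda>x y. P x \<longrightarrow> P y \<longrightarrow> R x y) xs"
  by (induction xs) auto

lemma disjoint_shuffles_iff:
  assumes "set xs \<inter> set ys = {}"
  shows "zs \<in> shuffles xs ys \<longleftrightarrow>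
    filter (\<lambda>x. x \<in> set xs) zs = xs \<and> filter (\<lambda>x. x \<notin> set xs) zs = ys"
  using assms filter_shuffles_disjoint1[of xs ys zs] partition_in_shuffles[of zs "\<lambda>x. x \<in> set xs"]
  by auto

text \<open>In the list of values of \<open>inv \<zeta>\<close> the number \<open>x\<close> stands
  at place \<open>\<zeta> x\<close>, so comparing values of \<open>\<zeta>\<close> is comparing
  places in this list.\<close>

lemma strict_mono_on_permutes_iff:
  fixes S :: "nat set"
  assumes "\<zeta> permutes {1..n}" "S \<subseteq> {1..n}"
  shows "strict_mono_on S \<zeta> \<longleftrightarrow>
    sorted_wrt (<) (filter (\<lambda>x. x \<in> S) (map (inv \<zeta>) [1..<n + 1]))"
proof -
  have inv: "inv \<zeta> (\<zeta> x) = x" "\<zeta> (inv \<zeta> x) = x" for x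
    using permutes_inverses[OF assms(1)] by auto
  have "sorted_wrt (<) (filter (\<lambda>x. x \<in> S) (map (inv \<zeta>) [1..<n + 1])) \<longleftrightarrow>
      (\<forall>i\<in>{1..n}. \<forall>j\<in>{1..n}. i < j \<longrightarrow> inv \<zeta> i \<in> S \<longrightarrow> inv \<zeta> j \<in> S \<longrightarrow> inv \<zeta> i < inv \<zeta> j)"
    (is "_ \<longleftrightarrow> ?R")
  proof -
    \<comment> \<open>The relation needed for \<open>Q\<close> ignores entries outside
      \<open>S\<close> and is not transitive in general, so all pairs are compared, not only
      neighbours.\<close>
    have "sorted_wrt Q [1..<n + 1] \<longleftrightarrow> (\<forall>i\<in>{1..n}. \<forall>j\<in>{1..n}. i < j \<longrightarrow> Q i j)" for Q
    proof (induction n)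
      case (Suc n)
      have "{1..Suc n} = insert (Suc n) {1..n}" by auto
      moreover have "set [1..<Suc n] = {1..n}" by auto
      ultimately show ?case
        using Suc.IH by (auto simp: sorted_wrt_append)
    qed simp
    then show ?thesis
      by (simp add: sorted_wrt_filter_iff sorted_wrt_map del: upt_Suc)
  qed
  also have "\<dots> \<longleftrightarrow> strict_mono_on S \<zeta>"
  proof
    assume R: ?R
    show "strict_mono_on S \<zeta>"
    proof (rule strict_mono_onI, rule ccontr)
      fix x y assume xy: "x \<in> S" "y \<in> S" "x < y" "\<not> \<zeta> x < \<zeta> y"
      then have "\<zeta> y < \<zeta> x"
        using injD[OF permutes_inj[OF assms(1)], of x y] by (cases "\<zeta> x = \<zeta> y") auto
      moreover have "\<zeta> x \<in> {1..n}" "\<zeta> y \<in> {1..n}"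
        using xy(1,2) assms(2) permutes_in_image[OF assms(1)] by (simp_all add: subset_iff)
      ultimately have "y < x" using R[rule_format, of "\<zeta> y" "\<zeta> x"] xy by (simp add: inv)
      then show False using xy by simp
    qed
  next
    assume "strict_mono_on S \<zeta>"
    then have "\<not> inv \<zeta> j < inv \<zeta> i" "inv \<zeta> j \<noteq> inv \<zeta> i"
      if "i < j" "inv \<zeta> i \<in> S" "inv \<zeta> j \<in> S" for i j
      using that strict_mono_onD[of S \<zeta> "inv \<zeta> j" "inv \<zeta> i"] inv(2)[of i] inv(2)[of j] by auto
    then show ?R by (meson linorder_neqE_nat)
  qed
  finally show ?thesis by (rule sym)
qed

text \<open>Monotonicity on the two blocks makes the two filtered sublists increasing. An increasing
  list is determined by its set, so the sublists are the two index intervals.\<close>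

lemma Sh_iff_shuffles:
  assumes "\<zeta> permutes {1..k + l}"
  shows "\<zeta> \<in> Sh k l \<longleftrightarrow>
    map (inv \<zeta>) [1..<k + l + 1] \<in> shuffles [1..<k + 1] [k + 1..<k + l + 1]"
proof -
  let ?L = "map (inv \<zeta>) [1..<k + l + 1]"
  have inv: "inv \<zeta> permutes {1..k + l}"
    using assms by (rule permutes_inv)
  have int: "set [1..<k + l + 1] = {1..k + l}" by auto
  have set: "set ?L = {1..k + l}"
    unfolding set_map int by (rule permutes_image[OF inv])
  have 1: "set (filter (\<lambda>x. x \<in> {1..k}) ?L) = set [1..<k + 1]"
    "set (filter (\<lambda>x. x \<in> {k + 1..k + l}) ?L) = set [k + 1..<k + l + 1]"
    unfolding set_filter set by auto
  have "filter (\<lambda>x. x \<notin> set [1..<k + 1]) ?L = filter (\<lambda>x. x \<in> {k + 1..k + l}) ?L"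
    by (rule filter_cong) (use set in auto)
  moreover have "filter (\<lambda>x. x \<in> set [1..<k + 1]) ?L = filter (\<lambda>x. x \<in> {1..k}) ?L"
    by (rule filter_cong) auto
  ultimately have "?L \<in> shuffles [1..<k + 1] [k + 1..<k + l + 1] \<longleftrightarrow>
      filter (\<lambda>x. x \<in> {1..k}) ?L = [1..<k + 1] \<and>
      filter (\<lambda>x. x \<in> {k + 1..k + l}) ?L = [k + 1..<k + l + 1]"
    by (subst disjoint_shuffles_iff) (simp_all del: upt_Suc)
  also have "\<dots> \<longleftrightarrow> sorted_wrt (<) (filter (\<lambda>x. x \<in> {1..k}) ?L) \<and>
      sorted_wrt (<) (filter (\<lambda>x. x \<in> {k + 1..k + l}) ?L)"
    using filter_eq_sorted_list_iff[OF _ 1(1)] filter_eq_sorted_list_iff[OF _ 1(2)]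
    by (simp del: upt_Suc)
  also have "\<dots> \<longleftrightarrow> strict_mono_on {1..k} \<zeta> \<and> strict_mono_on {k + 1..k + l} \<zeta>"
    using strict_mono_on_permutes_iff[OF assms, of "{1..k}"]
      strict_mono_on_permutes_iff[OF assms, of "{k + 1..k + l}"] by (simp del: upt_Suc)
  finally show ?thesis
    using assms by (simp add: Sh_def del: upt_Suc)
qed

lemma bij_betw_Sh_shuffles:
  "bij_betw (\<lambda>\<zeta>. map (inv \<zeta>) [1..<k + l + 1]) (Sh k l)
     (shuffles [1..<k + 1] [k + 1..<k + l + 1])"
  unfolding bij_betw_def
proof
  show "inj_on (\<lambda>\<zeta>. map (inv \<zeta>) [1..<k + l + 1]) (Sh k l)"
  proof (rule inj_onI)
    fix \<zeta> \<xi> assume "\<zeta> \<in> Sh k l" "\<xi> \<in> Sh k l"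
      and eq: "map (inv \<zeta>) [1..<k + l + 1] = map (inv \<xi>) [1..<k + l + 1]"
    then have perm: "\<zeta> permutes {1..k + l}" "\<xi> permutes {1..k + l}"
      by (auto simp: Sh_def)
    have "inv \<zeta> x = inv \<xi> x" for x
    proof (cases "x \<in> {1..k + l}")
      case True
      then show ?thesis using eq by (auto simp del: upt_Suc)
    next
      case False
      then show ?thesis using perm by (metis permutes_inv permutes_not_in)
    qed
    then have "inv \<zeta> = inv \<xi>" by blast
    then show "\<zeta> = \<xi>" using perm by (metis permutes_inv_inv)
  qed
next
  show "(\<lambda>\<zeta>. map (inv \<zeta>) [1..<k + l + 1]) ` Sh k l = shuffles [1..<k + 1] [k + 1..<k + l + 1]"
  proof (intro equalityI subsetI)
    fix L assume "L \<in> (\<lambda>\<zeta>. map (inv \<zeta>) [1..<k + l + 1]) ` Sh k l"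
    then show "L \<in> shuffles [1..<k + 1] [k + 1..<k + l + 1]"
      using Sh_iff_shuffles by (auto simp: Sh_def simp del: upt_Suc)
  next
    fix L assume L: "L \<in> shuffles [1..<k + 1] [k + 1..<k + l + 1]"
    then have len: "length L = k + l"
      using length_shuffles[OF L] by simp
    have "set [1..<k + 1] \<union> set [k + 1..<k + l + 1] = {1..k + l}"
      unfolding set_upt by auto
    then have set: "set L = {1..k + l}"
      using set_shuffles[OF L] by metis
    have dist: "distinct L"
      by (rule distinct_disjoint_shuffles[OF _ _ _ L]) (auto simp del: upt_Suc)
    \<comment> \<open>The permutation is read off from \<open>L\<close> and fixes everything outside
      the range; the preimage of \<open>L\<close> is then \<open>inv \<sigma>\<close>, because the
      bijection lists inverse values.\<close>
    define \<sigma> where "\<sigma> i = (if i \<in> {1..k + l} then L ! (i - 1) else i)" for i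
    have map: "map \<sigma> [1..<k + l + 1] = L"
      by (rule nth_equalityI) (auto simp: len \<sigma>_def simp del: upt_Suc)
    have "inj_on \<sigma> {1..k + l}"
      using dist by (auto simp: inj_on_def \<sigma>_def len nth_eq_iff_index_eq)
    moreover have "\<sigma> ` {1..k + l} = {1..k + l}"
      using arg_cong[OF map, of set] set
      by (metis atLeastLessThanSuc_atLeastAtMost Suc_eq_plus1 list.set_map set_upt)
    ultimately have "\<sigma> permutes {1..k + l}"
      by (intro bij_imp_permutes) (auto simp: bij_betw_def \<sigma>_def)
    then have "inv \<sigma> permutes {1..k + l}" "inv (inv \<sigma>) = \<sigma>"
      by (simp_all add: permutes_inv permutes_inv_inv)
    then show "L \<in> (\<lambda>\<zeta>. map (inv \<zeta>) [1..<k + l + 1]) ` Sh k l"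
      using L Sh_iff_shuffles[of "inv \<sigma>" k l] map by (auto simp del: upt_Suc intro!: rev_image_eqI)
  qed
qed

text \<open>The half of the shuffle product, with multiplicities, whose words end with the last
  letter of the left argument. Recursion on the first letter is chosen to fit the recursion of
  \<open>m_word\<close>.\<close>

fun left_last_shuffle :: "'a list \<Rightarrow> 'a list \<Rightarrow> ('a list \<Rightarrow>\<^sub>0 'k::comm_ring_1)" where
  "left_last_shuffle [] d = 0"
| "left_last_shuffle (x # c) [] = word (x # c)"
| "left_last_shuffle (x # c) (y # d) =
     prefix_concat [x] (left_last_shuffle c (y # d)) + prefix_concat [y] (left_last_shuffle (x # c) d)"

text \<open>Interleavings of distinct indices form a set without loss of multiplicity; relabelling
  by \<open>f\<close> afterwards may make words coincide, and the sum counts them all.\<close>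

lemma sum_shuffles_last:
  fixes f :: "'a \<Rightarrow> 'b"
  assumes "distinct xs" "distinct ys" "set xs \<inter> set ys = {}" "xs \<noteq> []"
  shows "(\<Sum>zs | zs \<in> shuffles xs ys \<and> last zs = last xs. word (map f zs)) =
    (left_last_shuffle (map f xs) (map f ys) :: 'b list \<Rightarrow>\<^sub>0 'k::comm_ring_1)"
  using assms
proof (induction xs ys rule: shuffles.induct)
  case (2 xs)
  then have "{zs \<in> shuffles xs []. last zs = last xs} = {xs}" by auto
  with 2 show ?case by (cases xs) auto
next
  case (3 x xs y ys)
  let ?e = "last (x # xs)"
  let ?A = "{zs \<in> shuffles xs (y # ys). last zs = ?e}"
  let ?B = "{zs \<in> shuffles (x # xs) ys. last zs = ?e}"
  have A: "(\<Sum>zs\<in>?A. word (map f zs)) =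
      (left_last_shuffle (map f xs) (map f (y # ys)) :: 'b list \<Rightarrow>\<^sub>0 'k)"
  proof (cases "xs = []")
    case True
    \<comment> \<open>With \<open>x\<close> placed first nothing is left on the left side, so the
      last entry comes from \<open>y # ys\<close>. This matches the value 0 of
      \<open>left_last_shuffle\<close> at an empty left word.\<close>
    then have "last (y # ys) \<noteq> ?e" using "3.prems" by auto
    with True have "?A = {}" by auto
    then have "(\<Sum>zs\<in>?A. word (map f zs)) = (0 :: 'b list \<Rightarrow>\<^sub>0 'k)"
      by (simp only: sum.empty)
    with True show ?thesis by simp
  qed (use 3 in auto)
  have B: "(\<Sum>zs\<in>?B. word (map f zs)) =
      (left_last_shuffle (map f (x # xs)) (map f ys) :: 'b list \<Rightarrow>\<^sub>0 'k)"
    using 3 by simp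
  have ne: "zs \<noteq> []" if "zs \<in> shuffles xs (y # ys) \<or> zs \<in> shuffles (x # xs) ys" for zs
    using that by (auto dest: length_shuffles)
  have "{zs \<in> shuffles (x # xs) (y # ys). last zs = ?e} = (#) x ` ?A \<union> (#) y ` ?B"
    using ne by (auto simp del: last.simps simp: last_ConsR)
  moreover have "(#) x ` ?A \<inter> (#) y ` ?B = {}" using "3.prems" by auto
  moreover have "finite ?A" "finite ?B" by auto
  ultimately have "(\<Sum>zs | zs \<in> shuffles (x # xs) (y # ys) \<and> last zs = ?e. word (map f zs)) =
      (\<Sum>zs\<in>(#) x ` ?A. word (map f zs) :: 'b list \<Rightarrow>\<^sub>0 'k) + (\<Sum>zs\<in>(#) y ` ?B. word (map f zs))"
    by (simp add: sum.union_disjoint)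
  also have "(\<Sum>zs\<in>(#) x ` ?A. word (map f zs)) = prefix_concat [f x] (\<Sum>zs\<in>?A. word (map f zs))"
    by (subst sum.reindex) (auto simp: linear_op_sum[OF linear_op_prefix_concat])
  also have "(\<Sum>zs\<in>(#) y ` ?B. word (map f zs)) = prefix_concat [f y] (\<Sum>zs\<in>?B. word (map f zs))"
    by (subst sum.reindex) (auto simp: linear_op_sum[OF linear_op_prefix_concat])
  finally show ?case by (simp add: A B del: last.simps)
qed simp

text \<open>Acting by \<open>\<zeta>\<close> means reading \<open>u\<close> along the list of values
  of \<open>inv \<zeta>\<close>, and \<open>inv \<zeta> (k + l)\<close> is the last entry of that
  list.\<close>

lemma sum_Sh_last:
  assumes "length u = k + l" "k + l > 0"
  shows "(\<Sum>\<zeta> | \<zeta> \<in> Sh k l \<and> inv \<zeta> (k + l) = e. word (perm_act \<zeta> u)) =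
    (\<Sum>zs | zs \<in> shuffles [1..<k + 1] [k + 1..<k + l + 1] \<and> last zs = e.
       word (map (\<lambda>j. u ! (j - 1)) zs))"
proof -
  let ?h = "\<lambda>\<zeta>. map (inv \<zeta>) [1..<k + l + 1]"
  have last: "last (?h \<zeta>) = inv \<zeta> (k + l)" for \<zeta> :: "nat \<Rightarrow> nat"
    using assms(2) by (simp add: last_map Suc_le_eq)
  have "bij_betw ?h {\<zeta> \<in> Sh k l. inv \<zeta> (k + l) = e}
     {zs \<in> shuffles [1..<k + 1] [k + 1..<k + l + 1]. last zs = e}"
  proof (rule bij_betw_subset[OF bij_betw_Sh_shuffles])
    show "?h ` {\<zeta> \<in> Sh k l. inv \<zeta> (k + l) = e} =
        {zs \<in> shuffles [1..<k + 1] [k + 1..<k + l + 1]. last zs = e}"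
      unfolding bij_betw_imp_surj_on[OF bij_betw_Sh_shuffles, symmetric] last[symmetric] by blast
  qed auto
  from sum.reindex_bij_betw[OF this, of "\<lambda>zs. word (map (\<lambda>j. u ! (j - 1)) zs)"]
  show ?thesis
    by (simp add: perm_act_def assms(1) comp_def del: upt_Suc)
qed

lemma map_nth_upt_append:
  "map (\<lambda>j. (u @ v) ! (j - 1)) [1..<length u + 1] = u"
  "map (\<lambda>j. (u @ v) ! (j - 1)) [length u + 1..<length u + length v + 1] = v"
  by (rule nth_equalityI; simp add: nth_append del: upt_Suc)+

lemma length_incr_last: "a \<noteq> [] \<Longrightarrow> length (incr_last a) = length a"
  by (simp add: incr_last_def)

text \<open>Here the final place is filled from index \<open>length a\<close>, that is, by the last
  letter of \<open>a\<close>.\<close>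

lemma prec_words_eq:
  assumes "a \<noteq> []" "b \<noteq> []"
  shows "prec_words a b = left_last_shuffle a (incr_last b)"
proof -
  let ?k = "length a" and ?l = "length b" and ?u = "a @ incr_last b"
  let ?xs = "[1..<?k + 1]" and ?ys = "[?k + 1..<?k + ?l + 1]"
  have "last ?xs = ?k" using assms by (simp add: Suc_le_eq)
  then have "prec_words a b = (\<Sum>zs | zs \<in> shuffles ?xs ?ys \<and> last zs = last ?xs.
      word (map (\<lambda>j. ?u ! (j - 1)) zs))"
    using sum_Sh_last[of ?u ?k ?l ?k] assms
    by (simp add: prec_words_def Sh_prec_def length_incr_last del: upt_Suc)
  also have "\<dots> = left_last_shuffle (map (\<lambda>j. ?u ! (j - 1)) ?xs) (map (\<lambda>j. ?u ! (j - 1)) ?ys)"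
    by (rule sum_shuffles_last) (use assms in \<open>auto simp: Suc_le_eq\<close>)
  also have "\<dots> = left_last_shuffle a (incr_last b)"
    using map_nth_upt_append[of a "incr_last b"] assms by (simp add: length_incr_last del: upt_Suc)
  finally show ?thesis .
qed

text \<open>Here the final place is filled by the last letter of \<open>b\<close>, so the index
  lists trade places.\<close>

lemma succ_words_eq:
  assumes "a \<noteq> []" "b \<noteq> []"
  shows "succ_words a b = left_last_shuffle b (incr_last a)"
proof -
  let ?k = "length a" and ?l = "length b" and ?u = "incr_last a @ b"
  let ?xs = "[1..<?k + 1]" and ?ys = "[?k + 1..<?k + ?l + 1]"
  have "last ?ys = ?k + ?l" using assms by (simp add: Suc_le_eq)
  then have "succ_words a b = (\<Sum>zs | zs \<in> shuffles ?ys ?xs \<and> last zs = last ?ys.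
      word (map (\<lambda>j. ?u ! (j - 1)) zs))"
    using sum_Sh_last[of ?u ?k ?l "?k + ?l"] assms
    by (simp add: succ_words_def Sh_succ_def length_incr_last shuffles_commutes del: upt_Suc)
  also have "\<dots> = left_last_shuffle (map (\<lambda>j. ?u ! (j - 1)) ?ys) (map (\<lambda>j. ?u ! (j - 1)) ?xs)"
    by (rule sum_shuffles_last) (use assms in \<open>auto simp: Suc_le_eq\<close>)
  also have "\<dots> = left_last_shuffle b (incr_last a)"
    using map_nth_upt_append[of "incr_last a" b] assms by (simp add: length_incr_last del: upt_Suc)
  finally show ?thesis .
qed

lemma star_word_word:
  assumes "a \<noteq> []" "b \<noteq> []"
  shows "word a \<star> word b = left_last_shuffle a (incr_last b) + left_last_shuffle b (incr_last a)"
  using assms by (simp add: star_def prec_def succ_def prec_words_eq succ_words_eq)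


section \<open>The prelie product of the elements indexed by words\<close>

lemma linear_op_m: "linear_op m"
  unfolding m_def by (rule linear_op_linear_ext)

lemmas m_linear [simp] = linear_op_add[OF linear_op_m] linear_op_zero[OF linear_op_m]

lemma m_word_word [simp]: "m (word w) = m_word w"
  by (simp add: m_def)

text \<open>The shuffle factor x1^(a-2) that a non-final letter \<open>a\<close> contributes to
  \<open>m_word\<close>. The value 0 below 2 encodes that the empty word annihilates everything
  under \<open>\<bullet>\<close>.\<close>

definition x1_pow :: "nat \<Rightarrow> (letter list \<Rightarrow>\<^sub>0 'k::comm_ring_1)" where
  "x1_pow a = (if a < 2 then 0 else word (replicate (a - 2) X1))"

lemma x1_power_prelie: "word (replicate (a - 1) X1) \<bullet> p = x1_pow a \<diamondop> x0 p"
proof (cases "a < 2")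
  case False
  then have "a - 1 = Suc (a - 2)" by simp
  with False replicate_X1_prelie[of "a - 2" p] show ?thesis by (simp add: x1_pow_def)
qed (auto simp: x1_pow_def)

lemma x1_pow_prelie: "x1_pow a \<bullet> p = x1_pow (a - 1) \<diamondop> x0 p"
  using x1_power_prelie[of "a - 1" p]
  by (auto simp: x1_pow_def[of a] x1_pow_def[of "a - 1"] numeral_2_eq_2)

lemma m_word_Cons: "w \<noteq> [] \<Longrightarrow> m_word (a # w) = x1_pow a \<diamondop> x0 (m_word w)"
  by (cases w) (simp_all add: x1_power_prelie[unfolded One_nat_def])

lemma m_word_single: "a \<ge> 1 \<Longrightarrow> m_word [a] = x1_pow (a + 1)"
  by (simp add: x1_pow_def)

lemma m_prefix_append:
  assumes "v \<noteq> []"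
  shows "m (prefix_concat (a # v) p) = x1_pow a \<diamondop> x0 (m (prefix_concat v p))"
  by (rule linear_op_eqI[of "\<lambda>p. m (prefix_concat _ p)"])
    (use assms in \<open>auto intro!: linear_op_comp[OF linear_op_m] linear_op_m linear_op_intros simp: m_word_Cons\<close>)

text \<open>The empty word never occurs in \<open>left_last_shuffle u v\<close>, so the letter
  \<open>a\<close> is never final and contributes the factor \<open>x1_pow a\<close>.\<close>

lemma m_prefix_left_last_shuffle:
  "m (prefix_concat [a] (left_last_shuffle u v)) = x1_pow a \<diamondop> x0 (m (left_last_shuffle u v))"
proof -
  have *: "m (prefix_concat [a] (prefix_concat [b] p)) = x1_pow a \<diamondop> x0 (m (prefix_concat [b] p))"
    for b p using m_prefix_append[of "[b]" a p] prefix_concat_append[of "[a]" "[b]" p] by simp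
  show ?thesis
    by (cases "(u, v)" rule: left_last_shuffle.cases) (auto simp: * m_word_Cons simp del: m_word.simps)
qed

lemma x0_shuffle_x0: "x0 p \<diamondop> x0 q = x0 (x0 p \<diamondop> q + p \<diamondop> x0 q)"
  by (simp add: add.commute)

text \<open>The two summands correspond to the first letter coming from the left or from the right
  word.\<close>

lemma m_left_last_shuffle_incr:
  assumes "y \<ge> 1"
  shows "m (left_last_shuffle (x # c) (incr_last (y # d))) =
    x1_pow x \<diamondop> x0 (m (left_last_shuffle c (incr_last (y # d)))) +
    (if d = [] then m_word [y] \<diamondop> x0 (m_word (x # c))
     else x1_pow y \<diamondop> x0 (m (left_last_shuffle (x # c) (incr_last d))))"
proof (cases "d = []")
  case True
  \<comment> \<open>The increased letter \<open>y + 1\<close> now stands in front of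
    \<open>x # c\<close> and contributes \<open>x1_pow (y + 1)\<close>, which is
    \<open>m_word [y]\<close>. The increment in \<open>\<star>\<close> compensates the exponent lost
    when a final letter becomes non-final.\<close>
  then show ?thesis
    by (simp add: incr_last_def m_prefix_left_last_shuffle m_word_Cons
        m_word_single[OF assms] del: m_word.simps)
next
  case False
  then have "incr_last (y # d) = y # incr_last d" by (simp add: incr_last_def)
  with False show ?thesis
    by (simp add: m_prefix_left_last_shuffle)
qed

lemma m_star_word:
  assumes "a \<noteq> []" "b \<noteq> []" "0 \<notin> set a" "0 \<notin> set b"
  shows "m (word a \<star> word b) =
    (x0 (m_word a) \<diamondop> m_word b + m_word a \<diamondop> x0 (m_word b) :: letter list \<Rightarrow>\<^sub>0 'k::comm_ring_1)"
  using assms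
proof (induction "length a + length b" arbitrary: a b rule: less_induct)
  case less
  then obtain x a' y b' where eq: "a = x # a'" "b = y # b'"
    by (metis neq_Nil_conv)
  have pos: "x \<ge> 1" "y \<ge> 1" using less.prems eq by auto
  let ?M = "\<lambda>c d. m (left_last_shuffle c (incr_last d)) :: letter list \<Rightarrow>\<^sub>0 'k"
  \<comment> \<open>By \<open>x0_shuffle_x0\<close>, the induction hypothesis under
    \<open>x0\<close> is a single shuffle of two elements starting with \<open>X0\<close>.\<close>
  have IH: "x0 (?M c d + ?M d c) = x0 (m_word c) \<diamondop> x0 (m_word d)"
    if "length c + length d < length a + length b" "c \<noteq> []" "d \<noteq> []" "0 \<notin> set c" "0 \<notin> set d" for c d
    unfolding x0_shuffle_x0 less.hyps[OF that, symmetric] star_word_word[OF that(2,3)] m_linear ..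
  \<comment> \<open>These are the terms of both halves whose first letter comes from
    \<open>a\<close>; those from \<open>b\<close> are collected next. If \<open>a'\<close> is empty,
    the half-shuffle with empty left word vanishes and one term remains.\<close>
  have a: "(if a' = [] then m_word [x] \<diamondop> x0 (m_word b) else x1_pow x \<diamondop> x0 (?M b a')) +
      x1_pow x \<diamondop> x0 (?M a' b) = m_word a \<diamondop> x0 (m_word b)"
  proof (cases "a' = []")
    case False
    then have "x1_pow x \<diamondop> x0 (?M b a' + ?M a' b) = m_word a \<diamondop> x0 (m_word b)"
      using less.prems eq IH[of b a'] by (simp add: m_word_Cons shuffle_ac del: shuffle_prefix_prefix)
    with False show ?thesis by simp
  qed (simp add: eq del: m_word.simps)
  have b: "(if b' = [] then m_word [y] \<diamondop> x0 (m_word a) else x1_pow y \<diamondop> x0 (?M a b')) +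
      x1_pow y \<diamondop> x0 (?M b' a) = x0 (m_word a) \<diamondop> m_word b"
  proof (cases "b' = []")
    case False
    then have "x1_pow y \<diamondop> x0 (?M a b' + ?M b' a) = x0 (m_word a) \<diamondop> m_word b"
      using less.prems eq IH[of a b'] by (simp add: m_word_Cons shuffle_ac del: shuffle_prefix_prefix)
    with False show ?thesis by simp
  qed (simp add: eq shuffle_commute del: m_word.simps)
  have "m (word a \<star> word b) = ?M a b + ?M b a"
    using less.prems by (simp add: star_word_word)
  also have "\<dots> = x0 (m_word a) \<diamondop> m_word b + m_word a \<diamondop> x0 (m_word b)"
    unfolding a[symmetric] b[symmetric]
    by (simp only: m_left_last_shuffle_incr[OF pos(2), of x a' b', folded eq]
        m_left_last_shuffle_incr[OF pos(1), of y b' a', folded eq] add_ac)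
  finally show ?case .
qed

lemma m_prefix_star_word:
  assumes "a \<noteq> []" "b \<noteq> []" "0 \<notin> set a" "0 \<notin> set b"
  shows "m (prefix_concat [x] (word a \<star> word b)) =
    (x1_pow x \<diamondop> (x0 (m_word a) \<diamondop> x0 (m_word b)) :: letter list \<Rightarrow>\<^sub>0 'k::comm_ring_1)"
proof -
  have "m (prefix_concat [x] (word a \<star> word b)) =
      (x1_pow x \<diamondop> x0 (m (word a \<star> word b)) :: letter list \<Rightarrow>\<^sub>0 'k)"
    using assms by (simp add: star_word_word m_prefix_left_last_shuffle)
  then show ?thesis
    by (simp only: m_star_word[OF assms] x0_shuffle_x0)
qed

text \<open>Induction on the left word: the derivation rule splits off its first letter.
  Differentiating the factor \<open>x1_pow x\<close> gives the first term of the sum,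
  differentiating the rest gives the later terms and the concatenation.\<close>

lemma m_word_prelie_m_word:
  assumes "a \<noteq> []" "b \<noteq> []" "0 \<notin> set a" "0 \<notin> set b"
  shows "m_word a \<bullet> m_word b =
    (\<Sum>i = 1..length a - 1.
       if a ! (i - 1) = 1 then 0
       else m (prefix_concat (take (i - 1) a @ [a ! (i - 1) - 1]) (word (drop i a) \<star> word b)))
    + (m_word (a @ b) :: letter list \<Rightarrow>\<^sub>0 'k::comm_ring_1)"
  using assms
proof (induction a)
  case (Cons x a)
  \<comment> \<open>The word is a parameter of \<open>T\<close> so that terms for \<open>a\<close>
    and for \<open>x # a\<close> can be compared.\<close>
  define T where "T c i = (if c ! (i - 1) = 1 then 0
       else m (prefix_concat (take (i - 1) c @ [c ! (i - 1) - 1]) (word (drop i c) \<star> word b)) :: letter list \<Rightarrow>\<^sub>0 'k)" for c i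
  show ?case
  proof (cases "a = []")
    case True
    with Cons.prems show ?thesis by (cases b) simp_all
  next
    case False
    have "m_word (x # a) \<bullet> m_word b =
        (x1_pow x \<bullet> m_word b) \<diamondop> x0 (m_word a) + x1_pow x \<diamondop> x0 (m_word a \<bullet> m_word b)"
      using False by (simp add: m_word_Cons prelie_shuffle)
    also have "(x1_pow x \<bullet> m_word b) \<diamondop> x0 (m_word a) = T (x # a) 1"
    proof (cases "x = 1")
      case True
      \<comment> \<open>The convention for a letter 1 agrees with the computation: the factor
        becomes \<open>x1_pow 0\<close>, which is 0.\<close>
      then show ?thesis by (simp add: T_def x1_pow_prelie) (simp add: x1_pow_def)
    next
      case x: False
      then show ?thesis
        using False Cons.prems
        by (simp add: T_def x1_pow_prelie m_prefix_star_word shuffle_assoc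
            shuffle_commute[of "x0 (m_word b)"] del: shuffle_prefix_prefix)
    qed
    also have "x1_pow x \<diamondop> x0 (m_word a \<bullet> m_word b) =
        (\<Sum>i = 1..length a - 1. T (x # a) (Suc i)) + m_word (x # a @ b)"
    proof -
      \<comment> \<open>Putting \<open>x\<close> in front shifts the index by one. The prefix in
        \<open>T a i\<close> is nonempty, so \<open>m_prefix_append\<close> applies.\<close>
      have T: "x1_pow x \<diamondop> x0 (T a i) = T (x # a) (Suc i)" if "i \<ge> 1" for i
        using that by (cases i) (simp_all add: T_def m_prefix_append)
      have "m_word a \<bullet> m_word b = (\<Sum>i = 1..length a - 1. T a i) + m_word (a @ b)"
        using False Cons by (simp add: T_def)
      then show ?thesis
        using False
        by (simp add: linear_op_sum[OF linear_op_comp[OF linear_op_shuffle_right linear_op_prefix_concat]]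
            T m_word_Cons)
    qed
    also have "T (x # a) 1 + ((\<Sum>i = 1..length a - 1. T (x # a) (Suc i)) + m_word (x # a @ b)) =
        (\<Sum>i = 1..length (x # a) - 1. T (x # a) i) + m_word ((x # a) @ b)"
    proof -
      have "length a = Suc (length a - 1)" using False by simp
      then have "(\<Sum>i = 1..length a. T (x # a) i) =
          T (x # a) 1 + (\<Sum>i = 1..length a - 1. T (x # a) (Suc i))"
        by (metis One_nat_def Suc_le_mono le0 sum.atLeast_Suc_atMost sum.shift_bounds_cl_Suc_ivl)
      then show ?thesis by (simp add: add.assoc)
    qed
    finally show ?thesis by (simp add: T_def)
  qed
qed simp

theorem theorem34:
  fixes a b :: "nat list"
  assumes "length a \<ge> 1" and "length b \<ge> 1"
    and "\<forall>x\<in>set a. x \<ge> 1" and "\<forall>x\<in>set b. x \<ge> 1"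
  shows "m (word a) \<bullet> m (word b) =
    (\<Sum>i = 1..length a - 1.
       if a ! (i - 1) = 1 then 0
       else m (prefix_concat (take (i - 1) a @ [a ! (i - 1) - 1]) (word (drop i a) \<star> word b)))
    + (m (word (a @ b)) :: letter list \<Rightarrow>\<^sub>0 'k::field_char_0)"
proof -
  have "a \<noteq> []" "b \<noteq> []" "0 \<notin> set a" "0 \<notin> set b"
    using assms by auto
  from m_word_prelie_m_word[OF this] show ?thesis
    by (simp only: m_word_word)
qed

end
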